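(* Let $1\le k\le n$ be integers and $\pi\in\mathcal{S}_n$. If $\pi\notin\mathcal{S}_n^k$, then $\mathrm{IPF}_k(n,\pi)=0$. Otherwise, \[\mathrm{IPF}_k(n,\pi)=\prod_{i=1}^{n-k}\min\{a_i(\pi),k\}\cdot\prod_{i=n-k+1}^{n}\min\{n-i-k+a_i(\pi)+1,\;n-i+1\}.\]
   Context: Let $[n]=\{1,\dots,n\}$, $\mathcal{S}_n$ the permutations of $[n]$ in one-line notation, and $\pi_i^{-1}$ the position $j$ with $\pi_j=i$. A tuple $(C_1,\dots,C_n)$ of non-empty subsets of $[n]$ is a subset parking function with outcome $\pi$ if for every $1\le i\le n$, $\pi_i^{-1}$ is the smallest element of $C_i\setminus\{\pi_{i'}^{-1}:i'<i\}$. A $k$-interval parking function is such a tuple in which every $C_i$ is an interval $\{a,\dots,a+k-1\}\subseteq[n]$ with exactly $k$ elements; $\mathrm{IPF}_k(n,\pi)$ counts those with outcome $\pi$. $\mathcal{S}_n^k$ is the set of $\pi\in\mathcal{S}_n$ with $\pi_n>\pi_{n-1}>\cdots>\pi_{n-k+1}$. For $1\le i\le n$, $a_i(\pi)$ is the largest $j$ with $1\le j\le i$ such that $\pi_i\ge\pi_{i'}$ for all $i-j+1\le i'\le i$. *)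

theory Defs
  imports "HOL-Combinatorics.Permutations" "HOL-Library.FuncSet"
begin

text \<open>
  A permutation of \<open>[n]\<close> is a function that \<open>permutes {1..n}\<close>; \<open>\<pi> i\<close> is the
  \<open>i\<close>-th entry of its one-line notation, so \<open>inv \<pi> i\<close> is the position of the value \<open>i\<close>.
  A tuple \<open>(C\<^sub>1, \<dots>, C\<^sub>n)\<close> is an extensional function on \<open>{1..n}\<close>, so that tuples can be counted.
\<close>

definition is_smallest :: "nat \<Rightarrow> nat set \<Rightarrow> bool" where
  "is_smallest x A \<longleftrightarrow> x \<in> A \<and> (\<forall>y\<in>A. x \<le> y)"

definition subset_parking_function :: "nat \<Rightarrow> (nat \<Rightarrow> nat) \<Rightarrow> (nat \<Rightarrow> nat set) \<Rightarrow> bool" where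
  "subset_parking_function n \<pi> C \<longleftrightarrow>
     C \<in> {1..n} \<rightarrow>\<^sub>E (Pow {1..n} - {{}}) \<and>
     (\<forall>i\<in>{1..n}. is_smallest (inv \<pi> i) (C i - {inv \<pi> i' | i'. 1 \<le> i' \<and> i' < i}))"

definition interval_parking_function ::
    "nat \<Rightarrow> nat \<Rightarrow> (nat \<Rightarrow> nat) \<Rightarrow> (nat \<Rightarrow> nat set) \<Rightarrow> bool" where
  "interval_parking_function k n \<pi> C \<longleftrightarrow>
     subset_parking_function n \<pi> C \<and>
     (\<forall>i\<in>{1..n}. \<exists>a. C i = {a..<a + k} \<and> {a..<a + k} \<subseteq> {1..n})"

definition IPF :: "nat \<Rightarrow> nat \<Rightarrow> (nat \<Rightarrow> nat) \<Rightarrow> nat" where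
  "IPF k n \<pi> = card {C. interval_parking_function k n \<pi> C}"

definition perms_final_increasing :: "nat \<Rightarrow> nat \<Rightarrow> (nat \<Rightarrow> nat) set" where
  "perms_final_increasing k n =
     {\<pi>. \<pi> permutes {1..n} \<and> (\<forall>i\<in>{n - k + 1..<n}. \<pi> (i + 1) > \<pi> i)}"

definition left_run :: "(nat \<Rightarrow> nat) \<Rightarrow> nat \<Rightarrow> nat" where
  "left_run \<pi> i = Max {j. 1 \<le> j \<and> j \<le> i \<and> (\<forall>i'\<in>{i - j + 1..i}. \<pi> i \<ge> \<pi> i')}"

end

theory Submission
  imports Defs
begin

text \<open>
  The car that ends up at position \<open>p\<close> carries the value \<open>\<pi> p\<close>, and its interval may start at
  \<open>a\<close> iff the interval contains \<open>p\<close>, lies in \<open>[n]\<close>, and all positions in \<open>[a, p)\<close> carry smaller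
  values. These conditions are independent for different \<open>p\<close>, so the count is a product over the
  positions, and the admissible starts \<open>a\<close> for \<open>p\<close> form an integer interval whose lower end is
  governed by \<open>left_run \<pi> p\<close>.
\<close>

definition interval_starts :: "nat \<Rightarrow> nat \<Rightarrow> (nat \<Rightarrow> nat) \<Rightarrow> nat \<Rightarrow> nat set" where
  "interval_starts k n \<pi> p =
     {a. 1 \<le> a \<and> a \<le> p \<and> p < a + k \<and> a + k \<le> n + 1 \<and> (\<forall>q\<in>{a..<p}. \<pi> q < \<pi> p)}"

lemma left_run_in:
  assumes "1 \<le> p"
  shows "left_run \<pi> p \<in> {j. 1 \<le> j \<and> j \<le> p \<and> (\<forall>q\<in>{p - j + 1..p}. \<pi> p \<ge> \<pi> q)}"
proof -
  let ?S = "{j. 1 \<le> j \<and> j \<le> p \<and> (\<forall>q\<in>{p - j + 1..p}. \<pi> p \<ge> \<pi> q)}"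
  have "finite ?S" by (rule finite_subset[of _ "{..p}"]) auto
  moreover have "1 \<in> ?S" using assms by auto
  ultimately show ?thesis unfolding left_run_def by (intro Max_in) auto
qed

lemma left_run_ge:
  assumes "1 \<le> j" "j \<le> p" "\<forall>q\<in>{p - j + 1..p}. \<pi> q \<le> \<pi> p"
  shows "j \<le> left_run \<pi> p"
  unfolding left_run_def
  by (rule Max_ge, rule finite_subset[of _ "{..p}"]) (use assms in auto)

text \<open>From left to right, \<open>{a..p}\<close> is a block over which \<open>\<pi> p\<close>
  is maximal, so its length is among those \<open>left_run\<close> maximizes. Conversely, the
  maximal block covers \<open>{a..p}\<close>, and injectivity makes its weak inequalities strict at
  \<open>q < p\<close>.\<close>

lemma smaller_before_iff_left_run:
  assumes "inj \<pi>" "1 \<le> a" "a \<le> p"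
  shows "(\<forall>q\<in>{a..<p}. \<pi> q < \<pi> p) \<longleftrightarrow> p < a + left_run \<pi> p"
proof
  assume smaller: "\<forall>q\<in>{a..<p}. \<pi> q < \<pi> p"
  have "\<pi> q \<le> \<pi> p" if "q \<in> {a..p}" for q
    using smaller that by (cases "q = p") (auto intro: less_imp_le)
  then have "p - a + 1 \<le> left_run \<pi> p"
    using assms by (intro left_run_ge) auto
  then show "p < a + left_run \<pi> p" using assms by linarith
next
  assume "p < a + left_run \<pi> p"
  then have "\<pi> q \<le> \<pi> p" "\<pi> q \<noteq> \<pi> p" if "q \<in> {a..<p}" for q
    using left_run_in[of p \<pi>] that assms inj_eq[OF assms(1), of q p] by auto
  then show "\<forall>q\<in>{a..<p}. \<pi> q < \<pi> p" by (simp add: order_less_le)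
qed

lemma interval_starts_eq:
  assumes "inj \<pi>" "k \<le> n" "1 \<le> p"
  shows "interval_starts k n \<pi> p = {p + 1 - min k (left_run \<pi> p)..min p (n + 1 - k)}"
proof -
  \<comment> \<open>This keeps the lower end \<open>p + 1 - min k (left_run \<pi> p)\<close> at
    least 1, so it absorbs the condition \<open>1 \<le> a\<close>.\<close>
  have "left_run \<pi> p \<le> p" using left_run_in[of p \<pi>] assms by auto
  then have "1 \<le> a \<and> a \<le> p \<and> p < a + k \<and> a + k \<le> n + 1 \<and> p < a + left_run \<pi> p \<longleftrightarrow>
      p + 1 - min k (left_run \<pi> p) \<le> a \<and> a \<le> min p (n + 1 - k)" for a
    using assms(2) by linarith
  moreover have "interval_starts k n \<pi> p =
      {a. 1 \<le> a \<and> a \<le> p \<and> p < a + k \<and> a + k \<le> n + 1 \<and> p < a + left_run \<pi> p}"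
    unfolding interval_starts_def
    by (rule Collect_cong)
      (use smaller_before_iff_left_run[OF assms(1), of _ p] in \<open>simp cong: conj_cong\<close>)
  ultimately show ?thesis
    by (simp only: atLeastAtMost_def atLeast_def atMost_def Int_def mem_Collect_eq)
qed

text \<open>The positions taken before car \<open>i\<close> arrives are those with values below
  \<open>i\<close>. So \<open>inv \<pi> i\<close> is the smallest one left exactly when it lies in
  the interval and every earlier position of the interval carries a smaller value.\<close>

lemma is_smallest_iff_interval_starts:
  assumes perm: "\<pi> permutes {1..n}" and i: "i \<in> {1..n}"
  shows "{a..<a + k} \<subseteq> {1..n} \<and> {a..<a + k} \<noteq> {} \<and>
      is_smallest (inv \<pi> i) ({a..<a + k} - {inv \<pi> i' | i'. 1 \<le> i' \<and> i' < i})
    \<longleftrightarrow> a \<in> interval_starts k n \<pi> (inv \<pi> i)" (is "?L \<longleftrightarrow> ?R")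
proof -
  define p where "p = inv \<pi> i"
  have ip: "i = \<pi> p" and p: "p \<in> {1..n}"
    using permutes_inverses(1)[OF perm] permutes_in_image[OF permutes_inv[OF perm]] i
    by (auto simp: p_def)
  have "y = inv \<pi> i' \<longleftrightarrow> i' = \<pi> y" for y i'
    using permutes_inv_eq[OF perm, of i' y] by auto
  then have earlier: "y \<in> {inv \<pi> i' | i'. 1 \<le> i' \<and> i' < i} \<longleftrightarrow> 1 \<le> \<pi> y \<and> \<pi> y < \<pi> p" for y
    using ip by simp
  have pos: "1 \<le> \<pi> y" if "y \<in> {1..n}" for y
    using permutes_in_image[OF perm, of y] that by auto
  \<comment> \<open>For \<open>k = 0\<close> the empty interval is a subset whatever
    \<open>a\<close> is; the conditions \<open>a \<le> p\<close> and \<open>p < a + k\<close> rule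
    this case out below.\<close>
  have sub: "{a..<a + k} \<subseteq> {1..n} \<longleftrightarrow> k = 0 \<or> 1 \<le> a \<and> a + k \<le> n + 1"
    using atLeastLessThan_subset_iff[of a "a + k" 1 "n + 1"]
    by (auto simp: atLeastLessThanSuc_atLeastAtMost)
  have smallest: "is_smallest p ({a..<a + k} - {inv \<pi> i' | i'. 1 \<le> i' \<and> i' < i}) \<longleftrightarrow>
      a \<le> p \<and> p < a + k \<and> (\<forall>y. a \<le> y \<and> y < a + k \<and> \<not> (1 \<le> \<pi> y \<and> \<pi> y < \<pi> p) \<longrightarrow> p \<le> y)"
    unfolding is_smallest_def Ball_def Diff_iff earlier by auto
  show ?thesis
    unfolding p_def[symmetric] smallest sub interval_starts_def
  proof (intro iffI CollectI, goal_cases)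
    case 1
    then have "\<pi> q < \<pi> p" if "a \<le> q" "q < p" for q
      using that by (meson leD order.strict_trans)
    then show ?case using 1 by auto
  next
    case 2
    then have "1 \<le> \<pi> y \<and> \<pi> y < \<pi> p" if "a \<le> y" "y < p" for y
      using that p pos[of y] by auto
    then have "p \<le> y" if "a \<le> y" "\<not> (1 \<le> \<pi> y \<and> \<pi> y < \<pi> p)" for y
      using that by (meson not_le)
    moreover have "1 \<le> a" "a + k \<le> n + 1" "a \<le> p" "p < a + k" using 2 by blast+
    ultimately show ?case by auto
  qed
qed

lemma interval_parking_functions_eq_PiE:
  assumes "\<pi> permutes {1..n}"
  shows "{C. interval_parking_function k n \<pi> C} =
    (\<Pi>\<^sub>E i\<in>{1..n}. (\<lambda>a. {a..<a + k}) ` interval_starts k n \<pi> (inv \<pi> i))" (is "?A = ?B")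
proof (intro equalityI subsetI)
  fix C assume "C \<in> ?A"
  then have C: "C \<in> {1..n} \<rightarrow>\<^sub>E (Pow {1..n} - {{}})"
    and sm: "\<And>i. i \<in> {1..n} \<Longrightarrow>
      is_smallest (inv \<pi> i) (C i - {inv \<pi> i' | i'. 1 \<le> i' \<and> i' < i})"
    and ex: "\<And>i. i \<in> {1..n} \<Longrightarrow> \<exists>a. C i = {a..<a + k} \<and> {a..<a + k} \<subseteq> {1..n}"
    by (auto simp: interval_parking_function_def subset_parking_function_def)
  show "C \<in> ?B"
  proof (rule PiE_I)
    fix i assume i: "i \<in> {1..n}"
    then obtain a where a: "C i = {a..<a + k}" "{a..<a + k} \<subseteq> {1..n}" using ex by blast
    have "C i \<noteq> {}" using PiE_mem[OF C i] by blast
    then have "a \<in> interval_starts k n \<pi> (inv \<pi> i)"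
      using is_smallest_iff_interval_starts[OF assms i, of a k] a sm[OF i] by simp
    then show "C i \<in> (\<lambda>a. {a..<a + k}) ` interval_starts k n \<pi> (inv \<pi> i)"
      using a(1) by blast
  qed (use PiE_arb[OF C] in auto)
next
  fix C assume C: "C \<in> ?B"
  have *: "\<exists>a. C i = {a..<a + k} \<and> {a..<a + k} \<subseteq> {1..n} \<and> {a..<a + k} \<noteq> {} \<and>
      is_smallest (inv \<pi> i) ({a..<a + k} - {inv \<pi> i' | i'. 1 \<le> i' \<and> i' < i})"
    if i: "i \<in> {1..n}" for i
    using PiE_mem[OF C i] is_smallest_iff_interval_starts[OF assms i] by blast
  have "C \<in> {1..n} \<rightarrow>\<^sub>E (Pow {1..n} - {{}})"
  proof (rule PiE_I)
    fix i assume "i \<in> {1..n}"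
    then show "C i \<in> Pow {1..n} - {{}}" using * by fastforce
  qed (use PiE_arb[OF C] in auto)
  moreover have "is_smallest (inv \<pi> i) (C i - {inv \<pi> i' | i'. 1 \<le> i' \<and> i' < i})"
    and "\<exists>a. C i = {a..<a + k} \<and> {a..<a + k} \<subseteq> {1..n}" if "i \<in> {1..n}" for i
    using *[OF that] by force+
  ultimately show "C \<in> ?A"
    by (auto simp: interval_parking_function_def subset_parking_function_def)
qed

lemma IPF_eq_prod:
  assumes "1 \<le> k" "\<pi> permutes {1..n}"
  shows "IPF k n \<pi> = (\<Prod>p = 1..n. card (interval_starts k n \<pi> p))"
proof -
  \<comment> \<open>For \<open>k \<ge> 1\<close> an interval determines its start, so counting
    intervals amounts to counting starts.\<close>
  have "inj (\<lambda>a::nat. {a..<a + k})"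
    using assms(1) by (intro injI) (simp add: atLeastLessThan_inj(1))
  then have "IPF k n \<pi> = (\<Prod>i = 1..n. card (interval_starts k n \<pi> (inv \<pi> i)))"
    unfolding IPF_def interval_parking_functions_eq_PiE[OF assms(2)]
    by (simp add: card_PiE card_image inj_on_subset)
  \<comment> \<open>Reindexing along \<open>inv \<pi>\<close> passes from cars to the positions
    where they park.\<close>
  also have "\<dots> = (\<Prod>p = 1..n. card (interval_starts k n \<pi> p))"
    using prod.permute[OF permutes_inv[OF assms(2)], of "\<lambda>p. card (interval_starts k n \<pi> p)"]
    by (simp add: o_def)
  finally show ?thesis .
qed

text \<open>The entries at positions \<open>n - k + 1\<close> to \<open>p\<close> increase, so this
  block of \<open>p - (n - k)\<close> positions bounds the run at \<open>p\<close> from below. The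
  bound makes the factors for the last \<open>k\<close> positions positive.\<close>

lemma final_increasing_left_run_ge:
  assumes "\<pi> \<in> perms_final_increasing k n" "k \<le> n" "p \<in> {n - k + 1..n}"
  shows "p + k \<le> n + left_run \<pi> p"
proof -
  have incr: "\<pi> i < \<pi> (Suc i)" if "n - k + 1 \<le> i" "i < n" for i
    using assms(1) that by (auto simp: perms_final_increasing_def)
  have "\<pi> q \<le> \<pi> p" if "n - k + 1 \<le> q" "q \<le> p" for q
    using that(2)
  \<comment> \<open>The induction starts at \<open>q = p\<close> and moves left one position at a
    time.\<close>
  proof (induction rule: inc_induct)
    case (step m)
    then show ?case using incr[of m] that assms(3) by simp
  qed simp
  then have "p - (n - k) \<le> left_run \<pi> p"
    using assms by (intro left_run_ge) auto
  then show ?thesis using assms by auto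
qed

text \<open>An interval of length \<open>k\<close> inside \<open>[n]\<close> starts at
  \<open>n - k + 1 \<le> i\<close> or earlier. If it contains \<open>i + 1\<close>, it therefore
  also contains \<open>i\<close>, whose value would have to be smaller.\<close>

lemma interval_starts_empty:
  assumes "k \<le> n" "i \<in> {n - k + 1..<n}" "\<not> \<pi> i < \<pi> (i + 1)"
  shows "interval_starts k n \<pi> (i + 1) = {}"
  using assms by (fastforce simp: interval_starts_def)

theorem theorem1p4:
  fixes k n :: nat and \<pi> :: "nat \<Rightarrow> nat"
  assumes "1 \<le> k" and "k \<le> n" and "\<pi> permutes {1..n}"
  shows "(\<pi> \<notin> perms_final_increasing k n \<longrightarrow> IPF k n \<pi> = 0) \<and>
    (\<pi> \<in> perms_final_increasing k n \<longrightarrow>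
      int (IPF k n \<pi>) =
        (\<Prod>i = 1..n - k. int (min (left_run \<pi> i) k)) *
        (\<Prod>i = n - k + 1..n.
           min (int n - int i - int k + int (left_run \<pi> i) + 1) (int n - int i + 1)))"
proof (intro conjI impI)
  assume "\<pi> \<notin> perms_final_increasing k n"
  then obtain i where i: "i \<in> {n - k + 1..<n}" "\<not> \<pi> i < \<pi> (i + 1)"
    using assms(3) by (auto simp: perms_final_increasing_def)
  \<comment> \<open>A descent among the last \<open>k\<close> positions yields a zero factor of the
    product.\<close>
  then have "card (interval_starts k n \<pi> (i + 1)) = 0" "i + 1 \<in> {1..n}"
    using interval_starts_empty[OF assms(2) i] by auto
  then show "IPF k n \<pi> = 0"
    unfolding IPF_eq_prod[OF assms(1,3)] by (metis finite_atLeastAtMost prod_zero)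
next
  assume fin: "\<pi> \<in> perms_final_increasing k n"
  let ?c = "\<lambda>p. int (card (interval_starts k n \<pi> p))"
  have c: "?c p = int (min p (n + 1 - k) + 1 - (p + 1 - min k (left_run \<pi> p)))"
    and run: "1 \<le> left_run \<pi> p" "left_run \<pi> p \<le> p" if "1 \<le> p" for p
    using interval_starts_eq[OF permutes_inj[OF assms(3)] assms(2) that]
      left_run_in[OF that, of \<pi>] by simp_all
  \<comment> \<open>Here \<open>p \<le> n - k\<close>, so the upper end of the interval of starts is
    \<open>p\<close> itself.\<close>
  have low: "?c p = int (min (left_run \<pi> p) k)" if "p \<in> {1..n - k}" for p
    using c[of p] run[of p] that by auto
  \<comment> \<open>Here the upper end is \<open>n + 1 - k\<close>. The lower bound on
    \<open>left_run\<close> ensures that the truncated subtraction in \<open>c\<close> agrees with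
    the integer one.\<close>
  have high: "?c p = min (int n - int p - int k + int (left_run \<pi> p) + 1) (int n - int p + 1)"
    if p: "p \<in> {n - k + 1..n}" for p
    using c[of p] run[of p] final_increasing_left_run_ge[OF fin assms(2) p] p assms(2)
    by (auto simp: min_def of_nat_diff)
  have "{1..n} = {1..n - k} \<union> {n - k + 1..n}" using assms by auto
  then have "int (IPF k n \<pi>) = (\<Prod>p = 1..n - k. ?c p) * (\<Prod>p = n - k + 1..n. ?c p)"
    unfolding IPF_eq_prod[OF assms(1,3)] of_nat_prod
    by (simp only:) (rule prod.union_disjoint; auto)
  then show "int (IPF k n \<pi>) =
        (\<Prod>i = 1..n - k. int (min (left_run \<pi> i) k)) *
        (\<Prod>i = n - k + 1..n.
           min (int n - int i - int k + int (left_run \<pi> i) + 1) (int n - int i + 1))"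
    using low high by simp
qed

end
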